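(* Let $p>1$ be a real number. Assume $N$ is a norm for which there exists $f\in L^{1}([0,1];\mathbb{C})$ such that $0<\|\Upsilon_{n}f(\cdot)\|_{N}<\infty$ for all integers $n\ge1$ and $\rho(f)>0$. Then, given any real numbers $l>0$ and $K>0$, there exists $g\in L^{1}([0,1];\mathbb{C})$ such that $\|g(\cdot)\|_{N}=l$ and $\rho(g)>K$.
   Context: Here $N$ denotes a norm $\|\cdot\|_N$ on complex-valued functions on $[0,1]$ that may take the value $+\infty$ on some elements of $L^1([0,1];\mathbb{C})$ (i.e. $\|h\|_N=\infty$ when $h$ does not lie in the normed space in question). For $f\in L^1([0,1];\mathbb{C})$ define $$A(f)=\left\{\theta\in C^{\infty}([0,1];\mathbb{R}):\int_{0}^{1}f(t)e^{i\theta(t)}\,dt=0\right\},$$ $$\rho(f)=\inf\left\{\int_{0}^{1}|\theta'(t)|^{p}\,dt:\theta\in A(f)\right\}$$ (so $\rho$ depends on the fixed exponent $p$), and, for an integer $n\ge 1$, $$(\Upsilon_{n}f)(t)=\begin{cases} f(2^{n}t) & \text{if }0\le t\le 2^{-n},\\ 0 & \text{otherwise,}\end{cases}\qquad t\in[0,1].$$ *)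

theory Defs
  imports "HOL-Analysis.Analysis"
begin

text \<open>
  Elements of \<open>L\<^sup>1([0,1]; \<complex>)\<close> are represented by functions on \<open>real\<close> that are Lebesgue integrable on
  \<open>{0..1}\<close>; values outside \<open>{0..1}\<close> are irrelevant.
\<close>

abbreviation unit_leb :: "real measure" where
  "unit_leb \<equiv> lebesgue_on {0..1}"

abbreviation L1 :: "(real \<Rightarrow> complex) set" where
  "L1 \<equiv> {f. integrable unit_leb f}"

text \<open>
  A norm on \<open>L1\<close>, modulo equality almost everywhere, that may take the value \<open>\<infinity>\<close>. Together with the
  triangle inequality, the first clause makes \<open>N\<close> invariant under changes on null subsets of
  \<open>{0..1}\<close> and under changes outside \<open>{0..1}\<close>. In \<^typ>\<open>ennreal\<close>, \<open>0 * \<infinity> = 0\<close> and \<open>r * \<infinity> = \<infinity>\<close> for \<open>r > 0\<close>,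
  so homogeneity is also the intended condition where \<open>N\<close> is infinite.
\<close>

definition extended_norm :: "((real \<Rightarrow> complex) \<Rightarrow> ennreal) \<Rightarrow> bool" where
  "extended_norm N \<longleftrightarrow>
     (\<forall>h\<in>L1. N h = 0 \<longleftrightarrow> (AE t in unit_leb. h t = 0)) \<and>
     (\<forall>c. \<forall>h\<in>L1. N (\<lambda>t. c * h t) = ennreal (cmod c) * N h) \<and>
     (\<forall>h\<in>L1. \<forall>k\<in>L1. N (\<lambda>t. h t + k t) \<le> N h + N k)"

text \<open>
  \<open>C\<^sup>\<infinity>\<close> on the closed interval, with one-sided derivatives at the endpoints: \<open>D n\<close> is the \<open>n\<close>-th
  derivative. Each \<open>D n\<close> is differentiable on \<open>{0..1}\<close>, hence continuous there.
\<close>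

definition smooth_unit :: "(real \<Rightarrow> real) \<Rightarrow> bool" where
  "smooth_unit \<theta> \<longleftrightarrow>
     (\<exists>D :: nat \<Rightarrow> real \<Rightarrow> real. D 0 = \<theta> \<and>
        (\<forall>n. \<forall>t\<in>{0..1}. (D n has_real_derivative D (Suc n) t) (at t within {0..1})))"

definition annihilating_phases :: "(real \<Rightarrow> complex) \<Rightarrow> (real \<Rightarrow> real) set" where
  "annihilating_phases f =
     {\<theta>. smooth_unit \<theta> \<and> (\<integral>t. f t * exp (\<i> * complex_of_real (\<theta> t)) \<partial>unit_leb) = 0}"

text \<open>The infimum of the empty set is \<open>\<infinity>\<close>.\<close>

definition rho :: "real \<Rightarrow> (real \<Rightarrow> complex) \<Rightarrow> ennreal" where
  "rho p f =
     (INF \<theta>\<in>annihilating_phases f.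
        \<integral>\<^sup>+t. ennreal (\<bar>vector_derivative \<theta> (at t within {0..1})\<bar> powr p) \<partial>unit_leb)"

definition Upsilon :: "nat \<Rightarrow> (real \<Rightarrow> complex) \<Rightarrow> real \<Rightarrow> complex" where
  "Upsilon n f t = (if 0 \<le> t \<and> t \<le> 1 / 2 ^ n then f (2 ^ n * t) else 0)"

end

theory Submission
  imports Defs
begin

text \<open>
  The energy \<open>\<integral>\<bar>\<theta>'\<bar>\<^sup>p\<close> is not scale invariant when \<open>p > 1\<close>: if a phase \<open>\<theta>\<close> annihilates the
  compressed function \<open>Upsilon n f\<close>, which lives on \<open>[0, 2\<^sup>-\<^sup>n]\<close>, then the stretched phase
  \<open>s \<mapsto> \<theta> (s / 2\<^sup>n)\<close> annihilates \<open>f\<close>, and its energy is at most \<open>(2\<^sup>n)\<close> to the power \<open>1 - p\<close> times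
  that of \<open>\<theta>\<close> (lemma \<open>energy_stretched_phase_le\<close>). Hence \<open>rho p (Upsilon n f)\<close> is at least
  \<open>(2\<^sup>n)\<close> to the power \<open>p - 1\<close> times \<open>rho p f\<close> (lemma \<open>rho_Upsilon_ge\<close>), which exceeds \<open>K\<close> for
  large \<open>n\<close> because \<open>rho p f > 0\<close>. Multiplying \<open>Upsilon n f\<close> by a nonzero constant leaves its annihilating phases, and
  therefore \<open>rho\<close>, unchanged, while homogeneity of \<open>N\<close> lets the constant be chosen so that the norm
  becomes exactly \<open>l\<close>.
\<close>

section \<open>Dilations of the Lebesgue integral\<close>

lemma
  fixes h :: "real \<Rightarrow> complex" and a :: real
  assumes h: "h \<in> borel_measurable lebesgue" and a: "a > 0"
  shows lebesgue_integrable_dilation: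
      "integrable lebesgue (\<lambda>t. h (a * t)) \<longleftrightarrow> integrable lebesgue h"
    and lebesgue_integral_dilation:
      "integral\<^sup>L lebesgue h = a *\<^sub>R (\<integral>t. h (a * t) \<partial>lebesgue)"
proof -
  have m: "(\<lambda>t. a * t) \<in> lebesgue \<rightarrow>\<^sub>M lebesgue"
    using lebesgue_measurable_scaling[of a, where 'a = real] by (simp add: real_scaleR_def[abs_def])
  have h': "h \<in> borel_measurable (distr lebesgue lebesgue (\<lambda>t. a * t))"
    using h by simp
  have eq: "lebesgue = density (distr lebesgue lebesgue (\<lambda>t. a * t)) (\<lambda>_. ennreal a)"
    using lebesgue_real_scale[of a] a by simp
  have "integrable lebesgue h \<longleftrightarrow>
      integrable (density (distr lebesgue lebesgue (\<lambda>t. a * t)) (\<lambda>_. ennreal a)) h"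
    using eq by simp
  also have "\<dots> \<longleftrightarrow> integrable (distr lebesgue lebesgue (\<lambda>t. a * t)) (\<lambda>t. a *\<^sub>R h t)"
    using a by (intro integrable_density h') auto
  also have "\<dots> \<longleftrightarrow> integrable lebesgue (\<lambda>t. a *\<^sub>R h (a * t))"
    using h by (intro integrable_distr_eq m) auto
  also have "\<dots> \<longleftrightarrow> integrable lebesgue (\<lambda>t. h (a * t))"
    using a integrable_scaleR_right[of "1 / a" lebesgue "\<lambda>t. a *\<^sub>R h (a * t)"] by auto
  finally show "integrable lebesgue (\<lambda>t. h (a * t)) \<longleftrightarrow> integrable lebesgue h" by blast
  have "integral\<^sup>L lebesgue h =
      integral\<^sup>L (density (distr lebesgue lebesgue (\<lambda>t. a * t)) (\<lambda>_. ennreal a)) h"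
    using eq by simp
  also have "\<dots> = integral\<^sup>L (distr lebesgue lebesgue (\<lambda>t. a * t)) (\<lambda>t. a *\<^sub>R h t)"
    using a by (intro integral_density h') auto
  also have "\<dots> = (\<integral>t. a *\<^sub>R h (a * t) \<partial>lebesgue)"
    using h by (intro integral_distr m) auto
  also have "\<dots> = a *\<^sub>R (\<integral>t. h (a * t) \<partial>lebesgue)"
    by (rule integral_scaleR_right)
  finally show "integral\<^sup>L lebesgue h = a *\<^sub>R (\<integral>t. h (a * t) \<partial>lebesgue)" .
qed

text \<open>
  Here the values of \<open>h\<close> outside \<open>[0, 1]\<close> are cut off before dilating, so that the integrand on the
  right vanishes outside \<open>[0, 1/a]\<close>.
\<close>

lemma
  fixes h :: "real \<Rightarrow> complex" and a :: real
  assumes h: "h \<in> borel_measurable unit_leb" and a: "a \<ge> 1"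
  shows integrable_unit_dilation:
      "integrable unit_leb (\<lambda>t. indicator {0..1} (a * t) *\<^sub>R h (a * t)) \<longleftrightarrow> integrable unit_leb h"
    and integral_unit_dilation:
      "integral\<^sup>L unit_leb h = a *\<^sub>R (\<integral>t. indicator {0..1} (a * t) *\<^sub>R h (a * t) \<partial>unit_leb)"
proof -
  let ?H = "\<lambda>s. indicator {0..1::real} s *\<^sub>R h s"
  have H: "?H \<in> borel_measurable lebesgue"
    using h by (subst (asm) borel_measurable_restrict_space_iff) auto
  have cut: "indicator {0..1} t *\<^sub>R ?H (a * t) = ?H (a * t)" for t
  proof (cases "t \<in> {0..1}")
    case False
    have "a * t \<notin> {0..1}"
    proof (cases "t < 0")
      case True
      then show ?thesis using a mult_pos_neg[of a t] by auto
    next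
      case nonneg: False
      with False have "1 < t" by auto
      moreover from this have "1 * t \<le> a * t" using a by (intro mult_right_mono) auto
      ultimately have "1 < a * t" by linarith
      then show ?thesis by simp
    qed
    then show ?thesis by simp
  qed simp
  show "integrable unit_leb (\<lambda>t. ?H (a * t)) \<longleftrightarrow> integrable unit_leb h"
    using lebesgue_integrable_dilation[OF H, of a] a by (simp add: integrable_restrict_space cut del: scaleR_scaleR)
  show "integral\<^sup>L unit_leb h = a *\<^sub>R (\<integral>t. ?H (a * t) \<partial>unit_leb)"
    using lebesgue_integral_dilation[OF H, of a] a by (simp add: integral_restrict_space cut del: scaleR_scaleR)
qed

lemma Upsilon_alt: "Upsilon n f t = indicator {0..1} (2 ^ n * t) *\<^sub>R f (2 ^ n * t)"
proof -
  have "0 \<le> 2 ^ n * t \<longleftrightarrow> 0 \<le> t"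
    using zero_less_power[of "2 :: real" n] zero_le_mult_iff[of "2 ^ n" t] by linarith
  moreover have "2 ^ n * t \<le> 1 \<longleftrightarrow> t \<le> 1 / 2 ^ n"
    by (simp add: pos_le_divide_eq mult.commute)
  ultimately show ?thesis
    by (simp add: Upsilon_def)
qed

lemma Upsilon_in_L1: "Upsilon n f \<in> L1" if "f \<in> L1"
  using that integrable_unit_dilation[of f "2 ^ n"] borel_measurable_integrable[of unit_leb f]
  by (simp add: Upsilon_alt[abs_def])

section \<open>Stretching phases\<close>

lemma smooth_unit_imp_continuous_on: "continuous_on {0..1} \<theta>" if "smooth_unit \<theta>"
  using that unfolding smooth_unit_def continuous_on_eq_continuous_within
  by (metis DERIV_continuous)

lemma smooth_unit_derivative:
  assumes "smooth_unit \<theta>"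
  obtains \<theta>' where "continuous_on {0..1} \<theta>'"
    and "\<And>t. t \<in> {0..1} \<Longrightarrow> (\<theta> has_real_derivative \<theta>' t) (at t within {0..1})"
proof -
  obtain D where D: "D 0 = \<theta>"
    "\<And>n t. t \<in> {0..1} \<Longrightarrow> (D n has_real_derivative D (Suc n) t) (at t within {0..1})"
    using assms unfolding smooth_unit_def by blast
  have "continuous_on {0..1} (D 1)"
    unfolding continuous_on_eq_continuous_within using D(2)[of _ 1] DERIV_continuous by blast
  moreover have "(\<theta> has_real_derivative D 1 t) (at t within {0..1})" if "t \<in> {0..1}" for t
    using D(2)[OF that, of 0] D(1) by simp
  ultimately show ?thesis using that by blast
qed

lemma has_real_derivative_stretch:
  fixes a :: real
  assumes a: "a \<ge> 1" and t: "t \<in> {0..1}"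
    and der: "\<And>s. s \<in> {0..1} \<Longrightarrow> (g has_real_derivative g' s) (at s within {0..1})"
  shows "((\<lambda>s. g (s / a)) has_real_derivative g' (t / a) / a) (at t within {0..1})"
proof -
  have sub: "(\<lambda>s. s / a) ` {0..1} \<subseteq> {0..1}"
    using a by (auto simp: divide_le_eq)
  have ta: "t / a \<in> {0..1}" using sub t by blast
  have "((\<lambda>s. s / a) has_real_derivative 1 / a) (at t within {0..1})"
    using a by (auto intro!: derivative_eq_intros)
  from DERIV_image_chain[OF DERIV_subset[OF der[OF ta] sub] this]
  show ?thesis by (simp add: o_def)
qed

lemma smooth_unit_stretch:
  fixes a :: real
  assumes a: "a \<ge> 1" and "smooth_unit \<theta>"
  shows "smooth_unit (\<lambda>s. \<theta> (s / a))"
proof -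
  obtain D where D: "D 0 = \<theta>"
    "\<And>n t. t \<in> {0..1} \<Longrightarrow> (D n has_real_derivative D (Suc n) t) (at t within {0..1})"
    using assms unfolding smooth_unit_def by blast
  let ?E = "\<lambda>n s. D n (s / a) / a ^ n"
  have "(?E n has_real_derivative ?E (Suc n) t) (at t within {0..1})" if t: "t \<in> {0..1}" for n t
    using DERIV_cdivide[OF has_real_derivative_stretch[OF a t D(2)], of n "a ^ n"] a
    by (simp add: field_simps)
  moreover have "?E 0 = (\<lambda>s. \<theta> (s / a))"
    using D(1) by simp
  ultimately show ?thesis
    unfolding smooth_unit_def by (intro exI[of _ ?E]) simp
qed

lemma annihilating_phases_stretch:
  assumes f: "f \<in> L1" and \<theta>: "\<theta> \<in> annihilating_phases (Upsilon n f)"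
  shows "(\<lambda>s. \<theta> (s / 2 ^ n)) \<in> annihilating_phases f"
proof -
  let ?a = "2 ^ n :: real"
  let ?h = "\<lambda>s. f s * exp (\<i> * complex_of_real (\<theta> (s / ?a)))"
  have smooth: "smooth_unit (\<lambda>s. \<theta> (s / ?a))"
    using \<theta> by (intro smooth_unit_stretch) (auto simp: annihilating_phases_def)
  have "f \<in> borel_measurable unit_leb"
    using f by auto
  moreover have "(\<lambda>s. exp (\<i> * complex_of_real (\<theta> (s / ?a)))) \<in> borel_measurable unit_leb"
    by (intro continuous_imp_measurable_on_sets_lebesgue continuous_intros
        smooth_unit_imp_continuous_on[OF smooth]) auto
  ultimately have "?h \<in> borel_measurable unit_leb"
    by measurable
  from integral_unit_dilation[OF this, of ?a]
  have "integral\<^sup>L unit_leb ?h =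
      ?a *\<^sub>R (\<integral>t. Upsilon n f t * exp (\<i> * complex_of_real (\<theta> t)) \<partial>unit_leb)"
    by (simp add: Upsilon_alt)
  also have "\<dots> = 0"
    using \<theta> by (simp add: annihilating_phases_def)
  finally show ?thesis
    using smooth by (simp add: annihilating_phases_def)
qed

text \<open>The functional minimised in \<^const>\<open>rho\<close>.\<close>

definition energy :: "real \<Rightarrow> (real \<Rightarrow> real) \<Rightarrow> ennreal" where
  "energy p \<theta> =
     (\<integral>\<^sup>+t. ennreal (\<bar>vector_derivative \<theta> (at t within {0..1})\<bar> powr p) \<partial>unit_leb)"

lemma rho_eq_INF_energy: "rho p f = (INF \<theta>\<in>annihilating_phases f. energy p \<theta>)"
  by (simp add: rho_def energy_def)

lemma energy_eq:
  assumes "\<And>t. t \<in> {0..1} \<Longrightarrow> (\<theta> has_real_derivative \<theta>' t) (at t within {0..1})"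
  shows "energy p \<theta> = (\<integral>\<^sup>+t. ennreal (\<bar>\<theta>' t\<bar> powr p) * indicator {0..1} t \<partial>lebesgue)"
proof -
  have "vector_derivative \<theta> (at t within {0..1}) = \<theta>' t" if "t \<in> {0..1}" for t
    using assms[OF that] that
    by (intro vector_derivative_within_closed_interval)
       (auto simp: has_real_derivative_iff_has_vector_derivative)
  then have "energy p \<theta> = (\<integral>\<^sup>+t. ennreal (\<bar>\<theta>' t\<bar> powr p) \<partial>unit_leb)"
    unfolding energy_def by (intro nn_integral_cong) simp
  then show ?thesis
    by (simp add: nn_integral_restrict_space)
qed

text \<open>
  One factor \<open>a\<close> comes from the change of variables and the factor \<open>a\<close> to the power \<open>-p\<close> from the
  chain rule; equality may fail, because only the part of the energy of \<open>\<theta>\<close> on \<open>[0, 1/a]\<close> is seen.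
\<close>

lemma energy_stretched_phase_le:
  fixes a :: real
  assumes a: "a \<ge> 1" and \<theta>: "smooth_unit \<theta>"
  shows "energy p (\<lambda>s. \<theta> (s / a)) \<le> ennreal (a powr (1 - p)) * energy p \<theta>"
proof -
  obtain \<theta>' where cont: "continuous_on {0..1} \<theta>'"
    and der: "\<And>t. t \<in> {0..1} \<Longrightarrow> (\<theta> has_real_derivative \<theta>' t) (at t within {0..1})"
    using smooth_unit_derivative[OF \<theta>] by blast
  let ?d = "\<lambda>s. \<theta>' (s / a) / a"
  let ?F = "\<lambda>s. ennreal (\<bar>?d s\<bar> powr p) * indicator {0..1::real} s"
  let ?G = "\<lambda>t. ennreal (\<bar>\<theta>' t\<bar> powr p) * indicator {0..1::real} t"
  have "continuous_on {0..1} ?d"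
    using a by (intro continuous_intros continuous_on_compose2[OF cont]) (auto simp: divide_le_eq)
  then have "?d \<in> borel_measurable unit_leb"
    by (rule continuous_imp_measurable_on_sets_lebesgue) simp
  then have "(\<lambda>s. ennreal (\<bar>?d s\<bar> powr p)) \<in> borel_measurable unit_leb"
    by measurable
  then have F: "?F \<in> borel_measurable lebesgue"
    by (subst (asm) borel_measurable_restrict_space_iff_ennreal) auto
  have "\<theta>' \<in> borel_measurable unit_leb"
    using cont by (rule continuous_imp_measurable_on_sets_lebesgue) simp
  then have "(\<lambda>t. ennreal (\<bar>\<theta>' t\<bar> powr p)) \<in> borel_measurable unit_leb"
    by measurable
  then have G: "?G \<in> borel_measurable lebesgue"
    by (subst (asm) borel_measurable_restrict_space_iff_ennreal) auto
  have le: "?F (a * t) \<le> ennreal (a powr (- p)) * ?G t" for t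
  proof (cases "a * t \<in> {0..1}")
    case True
    have "t \<le> a * t" if "0 \<le> t"
      using a that mult_right_mono[of 1 a t] by simp
    with True a have "t \<in> {0..1}"
      by (auto simp: zero_le_mult_iff)
    then show ?thesis
      using a True
      by (simp add: powr_divide powr_minus field_simps flip: ennreal_mult)
  qed simp
  have "energy p (\<lambda>s. \<theta> (s / a)) = integral\<^sup>N lebesgue ?F"
    using has_real_derivative_stretch[OF a _ der] by (intro energy_eq) auto
  also have "\<dots> = ennreal a * (\<integral>\<^sup>+t. ?F (a * t) \<partial>lebesgue)"
    using nn_integral_real_affine_lebesgue[OF F, of a 0] a by simp
  also have "\<dots> \<le> ennreal a * (\<integral>\<^sup>+t. ennreal (a powr (- p)) * ?G t \<partial>lebesgue)"
    by (intro mult_left_mono nn_integral_mono le) auto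
  also have "\<dots> = ennreal a * (ennreal (a powr (- p)) * energy p \<theta>)"
    using energy_eq[OF der, of p] by (simp add: nn_integral_cmult[OF G])
  also have "\<dots> = ennreal (a * a powr (- p)) * energy p \<theta>"
    using a by (simp add: ennreal_mult mult.assoc)
  also have "a * a powr (- p) = a powr (1 - p)"
    using a powr_add[of a 1 "- p"] by simp
  finally show ?thesis .
qed

section \<open>Behaviour of rho under compression and scaling\<close>

lemma rho_Upsilon_ge:
  assumes f: "f \<in> L1"
  shows "ennreal ((2 ^ n) powr (p - 1)) * rho p f \<le> rho p (Upsilon n f)"
  unfolding rho_eq_INF_energy[of p "Upsilon n f"]
proof (rule INF_greatest)
  fix \<theta> assume \<theta>: "\<theta> \<in> annihilating_phases (Upsilon n f)"
  let ?a = "2 ^ n :: real"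
  have "rho p f \<le> energy p (\<lambda>s. \<theta> (s / ?a))"
    unfolding rho_eq_INF_energy by (intro INF_lower annihilating_phases_stretch f \<theta>)
  also have "\<dots> \<le> ennreal (?a powr (1 - p)) * energy p \<theta>"
    using \<theta> by (intro energy_stretched_phase_le) (auto simp: annihilating_phases_def)
  finally have "ennreal (?a powr (p - 1)) * rho p f
      \<le> ennreal (?a powr (p - 1)) * (ennreal (?a powr (1 - p)) * energy p \<theta>)"
    by (intro mult_left_mono) auto
  also have "\<dots> = ennreal (?a powr (p - 1) * ?a powr (1 - p)) * energy p \<theta>"
    by (simp add: ennreal_mult mult.assoc)
  also have "?a powr (p - 1) * ?a powr (1 - p) = 1"
    by (simp flip: powr_add)
  finally show "ennreal (?a powr (p - 1)) * rho p f \<le> energy p \<theta>" by simp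
qed

lemma rho_cmult: "rho p (\<lambda>t. c * f t) = rho p f" if "c \<noteq> 0"
  using that by (simp add: rho_def annihilating_phases_def mult.assoc)

lemma exists_rho_Upsilon_gt:
  assumes p: "p > 1" and f: "f \<in> L1" and pos: "rho p f > 0"
  shows "\<exists>n\<ge>1. rho p (Upsilon n f) > ennreal K"
proof -
  obtain r where r: "r > 0" "ennreal r \<le> rho p f"
  proof (cases "rho p f")
    case (real x)
    then show thesis using pos that[of x] by simp
  next
    case top
    then show thesis using that[of 1] by simp
  qed
  let ?b = "2 powr (p - 1)"
  have b: "?b > 1"
    using p by simp
  obtain m where "max K 0 / r < ?b ^ m"
    using real_arch_pow[OF b] by blast
  also have "?b ^ m \<le> ?b ^ Suc m"
    using b by (intro power_increasing) auto
  also have "?b ^ Suc m = (2 ^ Suc m) powr (p - 1)"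
    by (simp add: powr_powr mult.commute[of _ "p - 1"] flip: powr_realpow del: power_Suc)
  finally have "max K 0 < (2 ^ Suc m) powr (p - 1) * r"
    using r by (simp only: pos_divide_less_eq)
  then have "ennreal K < ennreal ((2 ^ Suc m) powr (p - 1) * r)"
    by (intro ennreal_lessI) auto
  also have "\<dots> = ennreal ((2 ^ Suc m) powr (p - 1)) * ennreal r"
    using r by (intro ennreal_mult) auto
  also have "\<dots> \<le> ennreal ((2 ^ Suc m) powr (p - 1)) * rho p f"
    using r by (intro mult_left_mono) auto
  also have "\<dots> \<le> rho p (Upsilon (Suc m) f)"
    by (rule rho_Upsilon_ge[OF f])
  finally show ?thesis
    by (intro exI[of _ "Suc m"]) simp
qed

theorem theorem8:
  fixes p :: real and N :: "(real \<Rightarrow> complex) \<Rightarrow> ennreal" and l K :: real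
  assumes "p > 1"
    and "extended_norm N"
    and "\<exists>f\<in>L1. (\<forall>n\<ge>1. 0 < N (Upsilon n f) \<and> N (Upsilon n f) < \<infinity>) \<and> rho p f > 0"
    and "l > 0" and "K > 0"
  shows "\<exists>g\<in>L1. N g = ennreal l \<and> rho p g > ennreal K"
proof -
  obtain f where f: "f \<in> L1" "rho p f > 0"
    and fin: "\<And>n. n \<ge> 1 \<Longrightarrow> 0 < N (Upsilon n f) \<and> N (Upsilon n f) < \<infinity>"
    using assms(3) by blast
  obtain n where n: "n \<ge> 1" "rho p (Upsilon n f) > ennreal K"
    using exists_rho_Upsilon_gt[OF assms(1) f] by blast
  let ?u = "Upsilon n f"
  have u: "?u \<in> L1"
    using f(1) by (rule Upsilon_in_L1)
  obtain x where x: "x > 0" "N ?u = ennreal x"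
    using fin[OF n(1)] by (cases "N ?u") auto
  define c where "c = complex_of_real (l / x)"
  have c: "c \<noteq> 0" "cmod c = l / x"
    using x assms(4) by (auto simp: c_def norm_divide)
  let ?g = "\<lambda>t. c * ?u t"
  have "?g \<in> L1"
    using u by simp
  moreover have "N ?g = ennreal (cmod c) * N ?u"
    using assms(2) u unfolding extended_norm_def by blast
  then have "N ?g = ennreal l"
    using x assms(4) by (simp add: c(2) flip: ennreal_mult)
  moreover have "rho p ?g > ennreal K"
    using rho_cmult[OF c(1)] n(2) by simp
  ultimately show ?thesis by blast
qed

end
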